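(* Let $\chi^{(k)}$ denote the character of the standard representation of $S_k$, i.e. the irreducible character of $S_k$ indexed by the one-part partition $(k)$. Suppose that $\sigma$ is a labeled rooted forest with $m$ connected components. If $\widetilde{\sigma}$ is the labeled rooted forest obtained from $\sigma$ by adding $k$ isolated roots (hence it has $m+k$ connected components), then $$\chi^{o(\widetilde{\sigma})}=\chi^{(k)}\cdot\chi^{o(\sigma)}.$$
   Context: The symmetric group $S_n$ acts on labeled rooted forests with vertex set $[n]=\{1,\dots,n\}$ by permuting labels. For a labeled rooted forest $\sigma$ on $[n]$, $o(\sigma)$ is the permutation representation of $S_n$ on the orbit $S_n\cdot\sigma$, and $\chi^{o(\sigma)}$ is its character. The new vertices of $\widetilde\sigma$ are given labels $n+1,\dots,n+k$, where $n$ is the number of vertices of $\sigma$. The irreducible character of $S_k$ indexed by the partition $(k)$ is the trivial character. The product of a character $\chi$ of $S_p$ and a character $\psi$ of $S_q$ is the induction product $\chi\cdot\psi=\mathrm{Ind}_{S_p\times S_q}^{S_{p+q}}(\chi\otimes\psi)$.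
   Formalization: The formal theorem additionally assumes that the forest σ has no isolated roots of its own; without this the identity fails for every k ≥ 1 (e.g. σ a single vertex and k = 1: the degrees are 1 and 2). *)

theory Defs
  imports Complex_Main "HOL-Algebra.Sym_Groups" "HOL-Algebra.Group_Action"
begin

section \<open>Labeled rooted forests\<close>

text \<open>A rooted forest is an undirected acyclic graph with one distinguished vertex (the root)
  in each connected component.\<close>

record rforest =
  verts :: "nat set"
  edges :: "nat set set"
  roots :: "nat set"

definition connectivity :: "rforest \<Rightarrow> (nat \<times> nat) set" where
  "connectivity \<sigma> =
     {(u, v). u \<in> verts \<sigma> \<and> v \<in> verts \<sigma> \<and> (u, v) \<in> {(x, y). {x, y} \<in> edges \<sigma>}\<^sup>*}"

definition components :: "rforest \<Rightarrow> nat set set" where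
  "components \<sigma> = verts \<sigma> // connectivity \<sigma>"

definition is_cycle :: "rforest \<Rightarrow> nat list \<Rightarrow> bool" where
  "is_cycle \<sigma> vs \<longleftrightarrow> length vs \<ge> 3 \<and> distinct vs \<and>
     (\<forall>i < length vs. {vs ! i, vs ! (Suc i mod length vs)} \<in> edges \<sigma>)"

definition labeled_rooted_forest :: "nat \<Rightarrow> rforest \<Rightarrow> bool" where
  "labeled_rooted_forest n \<sigma> \<longleftrightarrow>
     verts \<sigma> = {1..n} \<and>
     (\<forall>e \<in> edges \<sigma>. e \<subseteq> verts \<sigma> \<and> card e = 2) \<and>
     (\<nexists>vs. is_cycle \<sigma> vs) \<and>
     roots \<sigma> \<subseteq> verts \<sigma> \<and>
     (\<forall>C \<in> components \<sigma>. \<exists>!r. r \<in> roots \<sigma> \<inter> C)"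

definition isolated_root :: "rforest \<Rightarrow> nat \<Rightarrow> bool" where
  "isolated_root \<sigma> v \<longleftrightarrow> v \<in> roots \<sigma> \<and> (\<forall>e \<in> edges \<sigma>. v \<notin> e)"

definition add_isolated_roots :: "nat \<Rightarrow> nat \<Rightarrow> rforest \<Rightarrow> rforest" where
  "add_isolated_roots n k \<sigma> =
     \<lparr> verts = verts \<sigma> \<union> {n+1..n+k}, edges = edges \<sigma>, roots = roots \<sigma> \<union> {n+1..n+k} \<rparr>"

definition relabel :: "(nat \<Rightarrow> nat) \<Rightarrow> rforest \<Rightarrow> rforest" where
  "relabel g \<sigma> = \<lparr> verts = g ` verts \<sigma>, edges = (\<lambda>e. g ` e) ` edges \<sigma>, roots = g ` roots \<sigma> \<rparr>"


section \<open>Characters\<close>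

text \<open>A representation on the complex vector space with finite basis \<open>X\<close> is given by operators
  on functions \<open>'b \<Rightarrow> complex\<close> (vanishing outside \<open>X\<close>); its character is the trace
  with respect to the basis of unit vectors.\<close>

definition rep_character ::
  "'b set \<Rightarrow> ('g \<Rightarrow> ('b \<Rightarrow> complex) \<Rightarrow> ('b \<Rightarrow> complex)) \<Rightarrow> 'g \<Rightarrow> complex" where
  "rep_character X \<rho> g = (\<Sum>x\<in>X. \<rho> g (\<lambda>y. if y = x then 1 else 0) x)"

text \<open>The linear extension of \<open>x \<mapsto> g \<cdot> x\<close>, that is \<open>(g v)(x) = v (g\<^sup>-\<^sup>1 \<cdot> x)\<close>.\<close>

definition permutation_rep ::
  "('g, 'm) monoid_scheme \<Rightarrow> ('g \<Rightarrow> 'b \<Rightarrow> 'b) \<Rightarrow> 'b set \<Rightarrow>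
     'g \<Rightarrow> ('b \<Rightarrow> complex) \<Rightarrow> ('b \<Rightarrow> complex)" where
  "permutation_rep G \<phi> X g v = (\<lambda>x. if x \<in> X then v (\<phi> (inv\<^bsub>G\<^esub> g) x) else 0)"

definition orbit_character :: "nat \<Rightarrow> rforest \<Rightarrow> (nat \<Rightarrow> nat) \<Rightarrow> complex" where
  "orbit_character n \<sigma> =
     (let X = orbit (sym_group n) relabel \<sigma>
      in rep_character X (permutation_rep (sym_group n) relabel X))"

text \<open>The irreducible character of \<open>S\<^sub>k\<close> indexed by the one-part partition \<open>(k)\<close> is
  the character of the trivial (one-dimensional) representation.\<close>

definition one_part_character :: "nat \<Rightarrow> (nat \<Rightarrow> nat) \<Rightarrow> complex" where
  "one_part_character k = restrict (rep_character (UNIV :: unit set) (\<lambda>g v. v)) (carrier (sym_group k))"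

text \<open>Frobenius' formula for the character of a finite group \<open>G\<close> induced from a subgroup \<open>H\<close>.\<close>

definition induced_character ::
  "('g, 'm) monoid_scheme \<Rightarrow> 'g set \<Rightarrow> ('g \<Rightarrow> complex) \<Rightarrow> 'g \<Rightarrow> complex" where
  "induced_character G H \<theta> g =
     (1 / of_nat (card H)) *
     (\<Sum>x | x \<in> carrier G \<and> inv\<^bsub>G\<^esub> x \<otimes>\<^bsub>G\<^esub> g \<otimes>\<^bsub>G\<^esub> x \<in> H. \<theta> (inv\<^bsub>G\<^esub> x \<otimes>\<^bsub>G\<^esub> g \<otimes>\<^bsub>G\<^esub> x))"

text \<open>\<open>S\<^sub>p \<times> S\<^sub>q\<close> inside \<open>S\<^sub>p\<^sub>+\<^sub>q\<close>: the first factor permutes \<open>{1..p}\<close>, the second one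
  permutes \<open>{p+1..p+q}\<close>.  The two projections to \<open>S\<^sub>p\<close> and \<open>S\<^sub>q\<close> follow.\<close>

definition young_subgroup :: "nat \<Rightarrow> nat \<Rightarrow> (nat \<Rightarrow> nat) set" where
  "young_subgroup p q = {h \<in> carrier (sym_group (p + q)). h ` {1..p} = {1..p}}"

definition young_fst :: "nat \<Rightarrow> (nat \<Rightarrow> nat) \<Rightarrow> nat \<Rightarrow> nat" where
  "young_fst p h = (\<lambda>i. if i \<in> {1..p} then h i else i)"

definition young_snd :: "nat \<Rightarrow> nat \<Rightarrow> (nat \<Rightarrow> nat) \<Rightarrow> nat \<Rightarrow> nat" where
  "young_snd p q h = (\<lambda>i. if i \<in> {1..q} then h (p + i) - p else i)"

definition induction_product ::
  "nat \<Rightarrow> nat \<Rightarrow> ((nat \<Rightarrow> nat) \<Rightarrow> complex) \<Rightarrow> ((nat \<Rightarrow> nat) \<Rightarrow> complex) \<Rightarrow>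
     (nat \<Rightarrow> nat) \<Rightarrow> complex" where
  "induction_product p q \<chi> \<psi> =
     induced_character (sym_group (p + q)) (young_subgroup p q)
       (\<lambda>h. \<chi> (young_fst p h) * \<psi> (young_snd p q h))"


section \<open>Isolated roots of the original forest\<close>

text \<open>Relabelings of the enlarged forest may exchange new isolated roots with isolated roots that
  were already present, and then the product formula for orbit characters fails: adding one
  isolated root to the one-vertex forest gives an orbit of size one, whereas the induction product
  has degree two.\<close>

lemma product_formula_fails_with_isolated_root:
  defines "\<sigma> \<equiv> \<lparr> verts = {1}, edges = {}, roots = {1} \<rparr>"
  shows "labeled_rooted_forest 1 \<sigma>"
    and "orbit_character 2 (add_isolated_roots 1 1 \<sigma>) id = 1"
    and "induction_product 1 1 (one_part_character 1) (orbit_character 1 \<sigma>) id = 2"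
proof -
  interpret S1: group "sym_group 1" by (rule sym_group_is_group)
  interpret S2: group "sym_group 2" by (rule sym_group_is_group)
  have inv_id: "inv\<^bsub>sym_group n\<^esub> id = id" for n
    using monoid.inv_one[OF group.is_monoid[OF sym_group_is_group]] by (simp add: sym_group_one)
  have rel_id: "relabel id \<tau> = \<tau>" for \<tau>
    by (simp add: relabel_def)
  have orb: "orbit_character n \<tau> id = of_nat (card (orbit (sym_group n) relabel \<tau>))" for n \<tau>
    by (simp add: orbit_character_def rep_character_def permutation_rep_def inv_id rel_id Let_def)
  show "labeled_rooted_forest 1 \<sigma>"
    by (auto simp: labeled_rooted_forest_def \<sigma>_def is_cycle_def components_def connectivity_def
        quotient_def intro!: exI[of _ 0])
  have "orbit (sym_group 2) relabel (add_isolated_roots 1 1 \<sigma>) = {add_isolated_roots 1 1 \<sigma>}"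
  proof -
    have "g ` {1, 2} = {1, 2}" if "g permutes {1..2::nat}" for g
      using permutes_image[OF that] by (simp add: numeral_2_eq_2 atLeastAtMostSuc_conv insert_commute)
    moreover have "add_isolated_roots 1 1 \<sigma> = \<lparr> verts = {1, 2}, edges = {}, roots = {1, 2} \<rparr>"
      by (auto simp: add_isolated_roots_def \<sigma>_def)
    ultimately show ?thesis
      using S2.one_closed
      by (auto simp: orbit_def relabel_def sym_group_carrier intro!: exI[of _ id] permutes_id)
  qed
  then show "orbit_character 2 (add_isolated_roots 1 1 \<sigma>) id = 1"
    by (simp add: orb)
  have id_iff: "h permutes {1..1::nat} \<longleftrightarrow> h = id" for h
    by (simp)
  have "orbit (sym_group 1) relabel \<sigma> = {\<sigma>}"
    by (auto simp: orbit_def sym_group_carrier rel_id)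
  then have c: "orbit_character 1 \<sigma> id = 1"
    by (simp add: orb)
  have young: "young_subgroup 1 1 = {id}"
  proof (intro equalityI subsetI)
    fix h assume "h \<in> young_subgroup 1 1"
    then have h: "h permutes {1..2}" "h 1 = 1"
      by (auto simp: young_subgroup_def sym_group_carrier numeral_2_eq_2)
    have "h 2 \<noteq> h 1"
      using permutes_inj[OF h(1)] by (simp add: inj_eq)
    then have "h 2 = 2"
      using permutes_in_image[OF h(1), of 2] h(2) by simp
    moreover have "{1..2::nat} = {1, 2}" by auto
    ultimately have "h x = x" for x
      using h permutes_not_in[OF h(1), of x] by (cases "x \<in> {1, 2}") auto
    then show "h \<in> {id}" by auto
  qed (auto simp: young_subgroup_def sym_group_carrier permutes_id)
  have p1: "one_part_character 1 id = 1"
    by (simp add: one_part_character_def rep_character_def sym_group_carrier)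
  have f: "young_fst 1 id = id" "young_snd 1 1 id = id"
    by (auto simp: young_fst_def young_snd_def fun_eq_iff)
  have conj: "inv\<^bsub>sym_group 2\<^esub> x \<otimes>\<^bsub>sym_group 2\<^esub> id \<otimes>\<^bsub>sym_group 2\<^esub> x = id"
    if "x \<in> carrier (sym_group 2)" for x
    using that S2.r_one[of "inv\<^bsub>sym_group 2\<^esub> x"] S2.l_inv[of x]
    by (simp add: sym_group_one sym_group_mult)
  have all: "{x. x \<in> carrier (sym_group 2) \<and>
        inv\<^bsub>sym_group 2\<^esub> x \<otimes>\<^bsub>sym_group 2\<^esub> id \<otimes>\<^bsub>sym_group 2\<^esub> x \<in> {id}} = carrier (sym_group 2)"
    using conj by auto
  have card2: "card (carrier (sym_group 2)) = 2"
    by (simp add: sym_group_def card_permutations[of _ 2])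
  have sum: "(\<Sum>x\<in>carrier (sym_group 2). \<theta> (inv\<^bsub>sym_group 2\<^esub> x \<otimes>\<^bsub>sym_group 2\<^esub> id \<otimes>\<^bsub>sym_group 2\<^esub> x))
      = (\<Sum>x\<in>carrier (sym_group 2). \<theta> id)" for \<theta> :: "(nat \<Rightarrow> nat) \<Rightarrow> complex"
    by (rule sum.cong[OF refl]) (simp only: conj)
  show "induction_product 1 1 (one_part_character 1) (orbit_character 1 \<sigma>) id = 2"
    unfolding induction_product_def induced_character_def one_add_one young all
      sum[where \<theta> = "\<lambda>h. one_part_character 1 (young_fst 1 h) * orbit_character 1 \<sigma> (young_snd 1 1 h)"]
      f p1 c
    by (simp add: card2)
qed

end

theory Submission
  imports Defs
begin

text \<open>Both sides count fixed points. Let \<open>E y\<close> be the forest \<open>y\<close> on \<open>[n]\<close> shifted by \<open>k\<close> and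
  enlarged by the isolated roots \<open>1, \<dots>, k\<close>, and let \<open>H = S\<^sub>k \<times> S\<^sub>n\<close>. Since \<open>1, \<dots>, k\<close> are the only
  isolated roots of \<open>E y\<close>, the equation \<open>x (E y) = E y'\<close> forces \<open>x \<in> H\<close>, and then says that the
  \<open>S\<^sub>n\<close>-component of \<open>x\<close> maps \<open>y\<close> to \<open>y'\<close>. Hence Frobenius' sum at \<open>g\<close> counts the pairs \<open>(x, y)\<close>
  for which \<open>g\<close> fixes \<open>x (E y)\<close>, and every fibre of \<open>(x, y) \<mapsto> x (E y)\<close> over the orbit of the enlarged
  forest has \<open>|H|\<close> elements.\<close>

section \<open>Relabeling as a group action\<close>

lemma relabel_id: "relabel id \<tau> = \<tau>"
  by (simp add: relabel_def)

lemma relabel_comp: "relabel (f \<circ> g) \<tau> = relabel f (relabel g \<tau>)"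
  by (simp add: relabel_def image_comp o_def image_image)

lemma relabel_inv_cancel:
  assumes "p permutes S"
  shows "relabel (inv' p) (relabel p \<tau>) = \<tau>" "relabel p (relabel (inv' p) \<tau>) = \<tau>"
  using permutes_inv_o[OF assms] by (simp_all flip: relabel_comp add: relabel_id)

lemma relabel_inv_eq_iff:
  assumes "p permutes S"
  shows "relabel (inv' p) \<tau> = \<tau>' \<longleftrightarrow> \<tau> = relabel p \<tau>'"
  using relabel_inv_cancel[OF assms] by metis

lemma isolated_root_relabel:
  assumes "inj g"
  shows "isolated_root (relabel g \<tau>) (g v) \<longleftrightarrow> isolated_root \<tau> v"
  by (auto simp: isolated_root_def relabel_def inj_image_mem_iff[OF assms])

section \<open>Orbit characters as fixed-point counts\<close>

lemma finite_orbit_sym_group: "finite (orbit (sym_group n) \<phi> \<tau>)"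
proof -
  have "orbit (sym_group n) \<phi> \<tau> = (\<lambda>g. \<phi> g \<tau>) ` {p. p permutes {1..n}}"
    by (auto simp: orbit_def sym_group_carrier)
  then show ?thesis by (simp add: finite_permutations)
qed

text \<open>In the basis of unit vectors the diagonal entry of \<open>g\<close> at \<tau> is 1 if
  the inverse of \<open>g\<close> fixes \<tau>, equivalently if \<open>g\<close> does, and 0
  otherwise.\<close>

lemma orbit_character_eq_card_fixed:
  assumes "g permutes {1..n}"
  shows "orbit_character n \<sigma> g =
    of_nat (card {\<tau> \<in> orbit (sym_group n) relabel \<sigma>. relabel g \<tau> = \<tau>})"
proof -
  define X where "X = orbit (sym_group n) relabel \<sigma>"
  have "finite X" unfolding X_def by (rule finite_orbit_sym_group)
  have inv: "inv\<^bsub>sym_group n\<^esub> g = inv' g"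
    using assms by (simp add: sym_group_carrier)
  have "orbit_character n \<sigma> g = (\<Sum>\<tau>\<in>X. if relabel g \<tau> = \<tau> then 1 else 0)"
    unfolding orbit_character_def Let_def rep_character_def permutation_rep_def X_def[symmetric] inv
    by (rule sum.cong) (auto simp: relabel_inv_eq_iff[OF assms])
  also have "\<dots> = of_nat (card {\<tau> \<in> X. relabel g \<tau> = \<tau>})"
    using \<open>finite X\<close> by (simp add: sum.If_cases Int_def)
  finally show ?thesis by (simp add: X_def)
qed

section \<open>The Young subgroup and its two projections\<close>

lemma young_subgroup_iff:
  "h \<in> young_subgroup k n \<longleftrightarrow> h permutes {1..k+n} \<and> h ` {1..k} = {1..k}"
  by (simp add: young_subgroup_def sym_group_carrier)

lemma id_in_young_subgroup: "id \<in> young_subgroup k n"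
  by (simp add: young_subgroup_iff permutes_id)

lemma young_subgroup_image_upper:
  assumes "h \<in> young_subgroup k n"
  shows "h ` {k+1..k+n} = {k+1..k+n}"
proof -
  have h: "h permutes {1..k+n}" "h ` {1..k} = {1..k}"
    using assms by (auto simp: young_subgroup_iff)
  have eq: "{k+1..k+n} = {1..k+n} - {1..k}" by auto
  show ?thesis
    unfolding eq using h by (simp add: image_set_diff[OF permutes_inj[OF h(1)]] permutes_image)
qed

text \<open>The truncated subtraction in \<open>young_snd\<close> loses nothing, because
  \<open>h\<close> keeps the upper block and so \<open>h (k + i)\<close> exceeds
  \<open>k\<close>.\<close>

lemma shift_young_snd:
  assumes "h \<in> young_subgroup k n" "i \<in> {1..n}"
  shows "k + young_snd k n h i = h (k + i)"
proof -
  have "h (k + i) \<in> h ` {k+1..k+n}" using assms(2) by auto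
  then have "h (k + i) \<in> {k+1..k+n}" by (simp only: young_subgroup_image_upper[OF assms(1)])
  then show ?thesis using assms(2) by (simp add: young_snd_def)
qed

lemma young_snd_permutes:
  assumes "h \<in> young_subgroup k n"
  shows "young_snd k n h permutes {1..n}"
proof (rule bij_imp_permutes)
  have inj: "inj_on (young_snd k n h) {1..n}"
  proof (rule inj_onI)
    fix i j assume ij: "i \<in> {1..n}" "j \<in> {1..n}" "young_snd k n h i = young_snd k n h j"
    then have "h (k + i) = h (k + j)"
      by (simp flip: shift_young_snd[OF assms])
    then show "i = j"
      using assms by (auto simp: young_subgroup_iff dest!: permutes_inj injD)
  qed
  have "young_snd k n h ` {1..n} \<subseteq> {1..n}"
  proof
    fix j assume "j \<in> young_snd k n h ` {1..n}"
    then obtain i where i: "i \<in> {1..n}" "j = young_snd k n h i" by auto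
    then have "k + j \<in> h ` {k+1..k+n}" by (auto simp: shift_young_snd[OF assms])
    then have "k + j \<in> {k+1..k+n}" by (simp only: young_subgroup_image_upper[OF assms])
    then show "j \<in> {1..n}" by auto
  qed
  then show "bij_betw (young_snd k n h) {1..n} {1..n}"
    using inj by (simp add: bij_betw_def endo_inj_surj)
qed (auto simp: young_snd_def)

text \<open>Needed to evaluate the trivial character: \<open>one_part_character\<close> is
  restricted to the carrier, so its value 1 is available only at permutations of
  \<open>{1..k}\<close>.\<close>

lemma young_fst_permutes:
  assumes "h \<in> young_subgroup k n"
  shows "young_fst k h permutes {1..k}"
proof (rule bij_imp_permutes)
  have "inj h" "h ` {1..k} = {1..k}"
    using assms by (auto simp: young_subgroup_iff dest: permutes_inj)
  then have "bij_betw h {1..k} {1..k}"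
    by (simp add: bij_betw_def inj_on_subset[OF _ subset_UNIV])
  then show "bij_betw (young_fst k h) {1..k} {1..k}"
    by (rule bij_betw_cong[THEN iffD1, rotated]) (simp add: young_fst_def)
qed (auto simp: young_fst_def)

section \<open>Moving the new isolated roots to the front\<close>

definition block_swap :: "nat \<Rightarrow> nat \<Rightarrow> nat \<Rightarrow> nat" where
  "block_swap n k i = (if i \<in> {1..n} then k + i else if i \<in> {n+1..n+k} then i - n else i)"

lemma block_swap_permutes: "block_swap n k permutes {1..k+n}"
proof (rule bij_imp_permutes)
  show "bij_betw (block_swap n k) {1..k+n} {1..k+n}"
    \<comment> \<open>Exchanging the two block lengths gives the inverse map.\<close>
    by (rule bij_betw_byWitness[where f' = "block_swap k n"]) (auto simp: block_swap_def)
qed (auto simp: block_swap_def)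

lemma block_swap_image_lower: "A \<subseteq> {1..n} \<Longrightarrow> block_swap n k ` A = (+) k ` A"
  by (rule image_cong) (auto simp: block_swap_def)

lemma block_swap_image_upper: "block_swap n k ` {n+1..n+k} = {1..k}"
proof
  show "{1..k} \<subseteq> block_swap n k ` {n+1..n+k}"
  proof
    fix i assume "i \<in> {1..k}"
    then show "i \<in> block_swap n k ` {n+1..n+k}"
      by (intro image_eqI[of _ _ "n + i"]) (auto simp: block_swap_def)
  qed
qed (auto simp: block_swap_def)

text \<open>The hypotheses on \<sigma> in a form that passes to its whole orbit, so that what
  follows applies to every \<open>y\<close> in that orbit.\<close>

definition isolated_free :: "nat \<Rightarrow> rforest \<Rightarrow> bool" where
  "isolated_free n \<tau> \<longleftrightarrow> verts \<tau> = {1..n} \<and> (\<forall>e \<in> edges \<tau>. e \<subseteq> {1..n}) \<and> roots \<tau> \<subseteq> {1..n} \<and>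
     (\<nexists>v. isolated_root \<tau> v)"

lemma isolated_free_relabel:
  assumes "isolated_free n \<tau>" "p permutes {1..n}"
  shows "isolated_free n (relabel p \<tau>)"
proof -
  have "\<not> isolated_root (relabel p \<tau>) v" for v
    using isolated_root_relabel[OF permutes_inj[OF assms(2)], of \<tau> "inv' p v"] assms
    by (simp add: isolated_free_def permutes_inverses)
  moreover have "p ` A \<subseteq> {1..n}" if "A \<subseteq> {1..n}" for A
    using image_mono[OF that, of p] by (simp only: permutes_image[OF assms(2)])
  ultimately show ?thesis
    using assms(1) permutes_image[OF assms(2)] by (simp add: isolated_free_def relabel_def)
qed

text \<open>The isolated roots are moved to the front, to match the convention that the factor
  \<open>S\<^sub>k\<close> of the Young subgroup acts on \<open>{1..k}\<close>.\<close>

definition front_roots :: "nat \<Rightarrow> nat \<Rightarrow> rforest \<Rightarrow> rforest" where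
  "front_roots n k \<tau> = relabel (block_swap n k) (add_isolated_roots n k \<tau>)"

text \<open>Edges and old roots lie in \<open>{1..n}\<close>, where the swap is the shift by
  \<open>k\<close>; the new roots land on \<open>{1..k}\<close>.\<close>

lemma front_roots_eq:
  assumes "isolated_free n \<tau>"
  shows "front_roots n k \<tau> = \<lparr> verts = {1..k+n}, edges = (`) ((+) k) ` edges \<tau>,
    roots = (+) k ` roots \<tau> \<union> {1..k} \<rparr>"
proof -
  have v: "{1..n} \<union> {n+1..n+k} = {1..k+n}" by auto
  have "(`) (block_swap n k) ` edges \<tau> = (`) ((+) k) ` edges \<tau>"
    using assms by (intro image_cong refl block_swap_image_lower) (auto simp: isolated_free_def)
  then show ?thesis
    using assms permutes_image[OF block_swap_permutes[of n k]]
    by (simp only: front_roots_def relabel_def add_isolated_roots_def isolated_free_def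
        rforest.simps image_Un[of _ "roots \<tau>"] block_swap_image_upper block_swap_image_lower v)
qed

lemma front_roots_inject:
  assumes "isolated_free n \<tau>" "isolated_free n \<tau>'" "front_roots n k \<tau> = front_roots n k \<tau>'"
  shows "\<tau> = \<tau>'"
proof -
  have inj: "inj ((+) k)" "inj ((`) ((+) k))" by (auto intro: inj_onI simp: inj_image_eq_iff)
  have "edges \<tau> = edges \<tau>'"
    using assms(3) by (simp add: front_roots_eq assms(1,2) inj_image_eq_iff[OF inj(2)])
  moreover have "roots \<tau> = roots \<tau>'"
  proof -
    \<comment> \<open>Shifted old roots exceed \<open>k\<close>, so removing \<open>{1..k}\<close>
      recovers them.\<close>
    have "(+) k ` roots \<rho> = ((+) k ` roots \<rho> \<union> {1..k}) - {1..k}" if "isolated_free n \<rho>" for \<rho>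
      using that by (fastforce simp: isolated_free_def)
    then have "(+) k ` roots \<tau> = (+) k ` roots \<tau>'"
      using assms by (metis front_roots_eq rforest.select_convs(3))
    then show ?thesis by (simp add: inj_image_eq_iff[OF inj(1)])
  qed
  moreover have "verts \<tau> = verts \<tau>'" using assms(1,2) by (simp add: isolated_free_def)
  ultimately show ?thesis by simp
qed

text \<open>Shifted edges only contain labels above \<open>k\<close>, which isolates
  \<open>1, ..., k\<close>. Every old root lies on an edge, and the shift preserves this.\<close>

lemma isolated_root_front_roots:
  assumes "isolated_free n \<tau>"
  shows "isolated_root (front_roots n k \<tau>) v \<longleftrightarrow> v \<in> {1..k}"
proof -
  have "v \<notin> (+) k ` e" if "v \<in> {1..k}" "e \<in> edges \<tau>" for e
    using assms that by (fastforce simp: isolated_free_def)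
  moreover have "\<exists>e\<in>edges \<tau>. k + i \<in> (+) k ` e" if "i \<in> roots \<tau>" for i
    using assms that unfolding isolated_free_def isolated_root_def by (metis imageI)
  ultimately show ?thesis
    by (auto simp: isolated_root_def front_roots_eq[OF assms])
qed

text \<open>The permutation \<open>h\<close> keeps the set \<open>{1..k}\<close> of added roots, and
  on the upper block it is \<open>young_snd k n h\<close> conjugated by the shift. Its
  \<open>S\<^sub>k\<close>-component thus has no effect.\<close>

lemma relabel_front_roots_young:
  assumes "isolated_free n \<tau>" "h \<in> young_subgroup k n"
  shows "relabel h (front_roots n k \<tau>) = front_roots n k (relabel (young_snd k n h) \<tau>)"
proof -
  have img: "h ` (+) k ` A = (+) k ` young_snd k n h ` A" if "A \<subseteq> {1..n}" for A
    unfolding image_image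
    by (rule image_cong) (use that in \<open>auto simp: shift_young_snd[OF assms(2)]\<close>)
  have edges: "(`) h ` (`) ((+) k) ` edges \<tau> = (`) ((+) k) ` (`) (young_snd k n h) ` edges \<tau>"
    unfolding image_image[of "(`) _" "(`) _"]
    using assms(1) by (intro image_cong refl img) (simp add: isolated_free_def)
  have "roots \<tau> \<subseteq> {1..n}" using assms(1) by (simp add: isolated_free_def)
  moreover have "h ` {1..k+n} = {1..k+n}" "h ` {1..k} = {1..k}"
    using assms(2) by (simp_all only: young_subgroup_iff permutes_image)
  ultimately show ?thesis
    unfolding front_roots_eq[OF assms(1)]
      front_roots_eq[OF isolated_free_relabel[OF assms(1) young_snd_permutes[OF assms(2)]]]
    by (simp only: relabel_def rforest.simps image_Un img edges)
qed

text \<open>This is where the absence of isolated roots in the original forest is needed: it makes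
  \<open>{1..k}\<close> the set of all isolated roots, which every relabeling has to respect.\<close>

lemma relabel_front_roots_eq_iff:
  assumes "isolated_free n \<tau>" "isolated_free n \<tau>'" "x permutes {1..k+n}"
  shows "relabel x (front_roots n k \<tau>) = front_roots n k \<tau>' \<longleftrightarrow>
    x \<in> young_subgroup k n \<and> relabel (young_snd k n x) \<tau> = \<tau>'"
proof
  assume eq: "relabel x (front_roots n k \<tau>) = front_roots n k \<tau>'"
  have "x v \<in> {1..k} \<longleftrightarrow> v \<in> {1..k}" for v
    using isolated_root_relabel[OF permutes_inj[OF assms(3)], of "front_roots n k \<tau>" v]
    by (simp only: eq isolated_root_front_roots[OF assms(1)] isolated_root_front_roots[OF assms(2)])
  then have "x ` {1..k} \<subseteq> {1..k}" by blast
  then have "x \<in> young_subgroup k n"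
    using assms(3) permutes_inj_on[OF assms(3)]
    by (simp add: young_subgroup_iff endo_inj_surj)
  moreover from this have "relabel (young_snd k n x) \<tau> = \<tau>'"
    using eq relabel_front_roots_young[OF assms(1)] front_roots_inject
      isolated_free_relabel[OF assms(1) young_snd_permutes] assms(2) by metis
  ultimately show "x \<in> young_subgroup k n \<and> relabel (young_snd k n x) \<tau> = \<tau>'" ..
next
  assume "x \<in> young_subgroup k n \<and> relabel (young_snd k n x) \<tau> = \<tau>'"
  then show "relabel x (front_roots n k \<tau>) = front_roots n k \<tau>'"
    using relabel_front_roots_young[OF assms(1)] by auto
qed

section \<open>The orbit of the enlarged forest and the fibres over it\<close>

lemma relabel_add_isolated_roots:
  assumes "p permutes {1..n}"
  shows "relabel p (add_isolated_roots n k \<tau>) = add_isolated_roots n k (relabel p \<tau>)"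
proof -
  have "p ` {n+1..n+k} = id ` {n+1..n+k}"
    by (rule image_cong) (auto intro: permutes_not_in[OF assms])
  then show ?thesis by (simp add: relabel_def add_isolated_roots_def image_Un)
qed

text \<open>If \<open>y\<close> is the image of \<sigma> under \<open>w\<close>, then
  \<open>w\<close> fixes all new labels and commutes with adding the roots. The forest in question
  is therefore the image of the enlarged \<sigma> under \<open>w\<close>, then the swap, then
  \<open>x\<close>.\<close>

lemma front_roots_in_orbit:
  assumes "y \<in> orbit (sym_group n) relabel \<sigma>" "x permutes {1..k+n}"
  shows "relabel x (front_roots n k y) \<in> orbit (sym_group (k + n)) relabel (add_isolated_roots n k \<sigma>)"
proof -
  obtain w where w: "w permutes {1..n}" "y = relabel w \<sigma>"
    using assms(1) by (auto simp: orbit_def sym_group_carrier)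
  have "w permutes {1..k+n}" using w(1) by (rule permutes_subset) auto
  then have "(x \<circ> block_swap n k) \<circ> w permutes {1..k+n}"
    by (intro permutes_compose assms(2) block_swap_permutes)
  moreover have "relabel x (front_roots n k y) =
      relabel ((x \<circ> block_swap n k) \<circ> w) (add_isolated_roots n k \<sigma>)"
    by (simp add: front_roots_def relabel_comp w(2) relabel_add_isolated_roots[OF w(1)])
  ultimately show ?thesis by (auto simp: orbit_def sym_group_carrier)
qed

text \<open>Every fibre is nonempty, already with second component \<sigma>: composing with the
  inverse of the swap changes the base point of the orbit.\<close>

lemma orbit_add_isolated_roots_cases:
  assumes "z \<in> orbit (sym_group (k + n)) relabel (add_isolated_roots n k \<sigma>)"
  obtains x where "x permutes {1..k+n}" "z = relabel x (front_roots n k \<sigma>)"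
proof -
  obtain g where g: "g permutes {1..k+n}" "z = relabel g (add_isolated_roots n k \<sigma>)"
    using assms by (auto simp: orbit_def sym_group_carrier)
  show thesis
  proof
    show "g \<circ> inv' (block_swap n k) permutes {1..k+n}"
      by (intro permutes_compose g(1) permutes_inv block_swap_permutes)
    show "z = relabel (g \<circ> inv' (block_swap n k)) (front_roots n k \<sigma>)"
      by (simp add: g(2) relabel_comp front_roots_def relabel_inv_cancel[OF block_swap_permutes])
  qed
qed

text \<open>Fix \<open>x0\<close> with \<open>z = relabel x0 (front_roots n k \<sigma>)\<close>. A
  pair \<open>(x, y)\<close> lies over \<open>z\<close> iff \<open>h = inv' x \<circ> x0\<close>
  takes \<open>front_roots n k \<sigma>\<close> to \<open>front_roots n k y\<close>, that is, iff
  \<open>h\<close> lies in the Young subgroup and its \<open>S\<^sub>n\<close>-component takes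
  \<sigma> to \<open>y\<close>. Hence \<open>h\<close> determines the pair and ranges over the whole
  subgroup.\<close>

lemma card_front_roots_fibre:
  assumes "isolated_free n \<sigma>"
    and "z \<in> orbit (sym_group (k + n)) relabel (add_isolated_roots n k \<sigma>)"
  shows "card {(x, y). x permutes {1..k+n} \<and> y \<in> orbit (sym_group n) relabel \<sigma> \<and>
      relabel x (front_roots n k y) = z} = card (young_subgroup k n)"
proof -
  let ?X = "orbit (sym_group n) relabel \<sigma>"
  let ?F = "{(x, y). x permutes {1..k+n} \<and> y \<in> ?X \<and> relabel x (front_roots n k y) = z}"
  obtain x0 where x0: "x0 permutes {1..k+n}" "z = relabel x0 (front_roots n k \<sigma>)"
    using assms(2) by (rule orbit_add_isolated_roots_cases)
  have free: "isolated_free n y" if "y \<in> ?X" for y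
    using that by (auto simp: orbit_def sym_group_carrier intro: isolated_free_relabel[OF assms(1)])
  have fibre: "relabel x (front_roots n k y) = z \<longleftrightarrow>
      inv' x \<circ> x0 \<in> young_subgroup k n \<and> y = relabel (young_snd k n (inv' x \<circ> x0)) \<sigma>"
    if "x permutes {1..k+n}" "y \<in> ?X" for x y
  proof -
    have "relabel x (front_roots n k y) = z \<longleftrightarrow>
        relabel (inv' x \<circ> x0) (front_roots n k \<sigma>) = front_roots n k y"
      unfolding relabel_comp relabel_inv_eq_iff[OF that(1)] x0(2) by (rule eq_commute)
    also have "\<dots> \<longleftrightarrow>
        inv' x \<circ> x0 \<in> young_subgroup k n \<and> relabel (young_snd k n (inv' x \<circ> x0)) \<sigma> = y"
      by (intro relabel_front_roots_eq_iff assms(1) free that permutes_compose permutes_inv x0(1))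
    finally show ?thesis by blast
  qed
  have "bij_betw (\<lambda>(x, y). inv' x \<circ> x0) ?F (young_subgroup k n)"
  proof (rule bij_betw_byWitness[where
        f' = "\<lambda>h. (x0 \<circ> inv' h, relabel (young_snd k n h) \<sigma>)"])
    \<comment> \<open>Used with \<open>p = x0\<close>, these are the two round trips between
      \<open>x\<close> and \<open>h\<close>: \<open>inv\<close> starts from \<open>h\<close>,
      \<open>inv2\<close> from \<open>x\<close>.\<close>
    have inv: "inv' (p \<circ> inv' q) \<circ> p = q" if "p permutes {1..k+n}" "q permutes {1..k+n}" for p q
      using that[THEN permutes_bij]
      by (simp add: o_inv_distrib bij_imp_bij_inv inv_inv_eq comp_assoc permutes_inv_o(2)[OF that(1)])
    have inv2: "p \<circ> inv' (inv' q \<circ> p) = q" if "p permutes {1..k+n}" "q permutes {1..k+n}" for p q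
      using that[THEN permutes_bij]
      by (simp add: o_inv_distrib bij_imp_bij_inv inv_inv_eq o_assoc permutes_inv_o(1)[OF that(1)])
    show "\<forall>p\<in>?F. (\<lambda>h. (x0 \<circ> inv' h, relabel (young_snd k n h) \<sigma>))
        ((\<lambda>(x, y). inv' x \<circ> x0) p) = p"
      using fibre inv2[OF x0(1)] by auto
    show "\<forall>h\<in>young_subgroup k n.
        (\<lambda>(x, y). inv' x \<circ> x0) (x0 \<circ> inv' h, relabel (young_snd k n h) \<sigma>) = h"
      using inv[OF x0(1)] by (auto simp: young_subgroup_iff)
    show "(\<lambda>(x, y). inv' x \<circ> x0) ` ?F \<subseteq> young_subgroup k n"
      using fibre by auto
    show "(\<lambda>h. (x0 \<circ> inv' h, relabel (young_snd k n h) \<sigma>)) ` young_subgroup k n \<subseteq> ?F"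
    proof (rule image_subsetI)
      fix h assume h: "h \<in> young_subgroup k n"
      then have hp: "h permutes {1..k+n}" by (simp add: young_subgroup_iff)
      then have "x0 \<circ> inv' h permutes {1..k+n}"
        by (intro permutes_compose permutes_inv x0(1))
      moreover have "relabel (young_snd k n h) \<sigma> \<in> ?X"
        using young_snd_permutes[OF h] by (auto simp: orbit_def sym_group_carrier)
      ultimately show "(x0 \<circ> inv' h, relabel (young_snd k n h) \<sigma>) \<in> ?F"
        using fibre inv[OF x0(1) hp] h by simp
    qed
  qed
  then show ?thesis by (rule bij_betw_same_card)
qed

section \<open>Comparison of the two characters\<close>

text \<open>In Frobenius' formula the trivial factor is 1 and the other factor is a fixed-point
  count; both evaluations are legitimate because the conjugate lies in the Young subgroup.\<close>

lemma induction_product_eq_sum: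
  assumes "g permutes {1..k+n}"
  shows "induction_product k n (one_part_character k) (orbit_character n \<sigma>) g =
    (\<Sum>x | x permutes {1..k+n} \<and> inv' x \<circ> g \<circ> x \<in> young_subgroup k n.
        of_nat (card {y \<in> orbit (sym_group n) relabel \<sigma>.
          relabel (young_snd k n (inv' x \<circ> g \<circ> x)) y = y})) / of_nat (card (young_subgroup k n))"
proof -
  have inv: "inv\<^bsub>sym_group (k + n)\<^esub> x = inv' x" if "x permutes {1..k+n}" for x
    using that by (simp add: sym_group_carrier)
  have idx: "{x \<in> carrier (sym_group (k + n)). inv\<^bsub>sym_group (k + n)\<^esub> x \<circ> g \<circ> x \<in> young_subgroup k n} =
      {x. x permutes {1..k+n} \<and> inv' x \<circ> g \<circ> x \<in> young_subgroup k n}"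
    using inv by (auto simp: sym_group_carrier)
  have one: "one_part_character k (young_fst k h) = 1" if "h \<in> young_subgroup k n" for h
    using young_fst_permutes[OF that]
    by (simp add: one_part_character_def rep_character_def sym_group_carrier)
  show ?thesis
    unfolding induction_product_def induced_character_def sym_group_mult idx
    by (simp add: inv one orbit_character_eq_card_fixed[OF young_snd_permutes])
qed

lemma orbit_character_add_isolated_roots:
  assumes "isolated_free n \<sigma>" "g permutes {1..k+n}"
  shows "orbit_character (k + n) (add_isolated_roots n k \<sigma>) g =
    induction_product k n (one_part_character k) (orbit_character n \<sigma>) g"
proof -
  let ?G = "{x. x permutes {1..k+n}}"
  let ?H = "young_subgroup k n"
  let ?X = "orbit (sym_group n) relabel \<sigma>"
  let ?E = "front_roots n k"
  let ?Z = "{z \<in> orbit (sym_group (k + n)) relabel (add_isolated_roots n k \<sigma>). relabel g z = z}"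
  let ?F = "\<lambda>z. {(x, y). x permutes {1..k+n} \<and> y \<in> ?X \<and> relabel x (?E y) = z}"
  let ?S = "\<lambda>x. {y \<in> ?X. relabel g (relabel x (?E y)) = relabel x (?E y)}"
  have finG: "finite ?G" by (simp add: finite_permutations)
  have finX: "finite ?X" by (rule finite_orbit_sym_group)
  have finZ: "finite ?Z" by (simp add: finite_orbit_sym_group)
  have finH: "finite ?H" by (rule finite_subset[OF _ finG]) (auto simp: young_subgroup_iff)
  have free: "isolated_free n y" if "y \<in> ?X" for y
    using that by (auto simp: orbit_def sym_group_carrier intro: isolated_free_relabel[OF assms(1)])
  \<comment> \<open>Conjugation by \<open>x\<close> turns fixing \<open>relabel x (?E y)\<close>
    into fixing \<open>?E y\<close>, to which the criterion for equality of such forests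
    applies.\<close>
  have S: "relabel g (relabel x (?E y)) = relabel x (?E y) \<longleftrightarrow>
      inv' x \<circ> g \<circ> x \<in> ?H \<and> relabel (young_snd k n (inv' x \<circ> g \<circ> x)) y = y"
    if x: "x permutes {1..k+n}" and y: "y \<in> ?X" for x y
  proof -
    have "relabel g (relabel x (?E y)) = relabel x (?E y) \<longleftrightarrow>
        relabel (inv' x \<circ> g \<circ> x) (?E y) = ?E y"
      unfolding relabel_comp relabel_inv_eq_iff[OF x] ..
    also have "\<dots> \<longleftrightarrow> inv' x \<circ> g \<circ> x \<in> ?H \<and> relabel (young_snd k n (inv' x \<circ> g \<circ> x)) y = y"
      by (intro relabel_front_roots_eq_iff free[OF y] permutes_compose permutes_inv x assms(2))
    finally show ?thesis .
  qed
  have "(\<Sum>x | x permutes {1..k+n} \<and> inv' x \<circ> g \<circ> x \<in> ?H.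
        card {y \<in> ?X. relabel (young_snd k n (inv' x \<circ> g \<circ> x)) y = y}) = (\<Sum>x\<in>?G. card (?S x))"
  \<comment> \<open>If the conjugate of \<open>g\<close> by \<open>x\<close> is outside
    \<open>?H\<close>, no \<open>y\<close> is counted, so the sum may run over the whole
    group.\<close>
  proof (rule sum.mono_neutral_cong_left)
    show "\<forall>x\<in>?G - {x. x permutes {1..k+n} \<and> inv' x \<circ> g \<circ> x \<in> ?H}. card (?S x) = 0"
      using S by (auto simp: card_eq_0_iff)
  qed (use finG S in \<open>auto intro!: arg_cong[where f = card]\<close>)
  also have "\<dots> = card (Sigma ?G ?S)"
    using finG finX by (simp add: card_SigmaI)
  \<comment> \<open>The pairs are regrouped by the forest \<open>z = relabel x (?E y)\<close>, which
    \<open>g\<close> fixes.\<close>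
  also have "Sigma ?G ?S = (\<Union>z\<in>?Z. ?F z)"
    using front_roots_in_orbit by (auto; blast)
  also have "card \<dots> = (\<Sum>z\<in>?Z. card (?F z))"
  proof (rule card_UN_disjoint[OF finZ])
    show "\<forall>z\<in>?Z. finite (?F z)"
      by (intro ballI finite_subset[OF _ finite_cartesian_product[OF finG finX]]) auto
  qed auto
  also have "\<dots> = card ?Z * card ?H"
    using card_front_roots_fibre[OF assms(1)] by simp
  finally have "(\<Sum>x | x permutes {1..k+n} \<and> inv' x \<circ> g \<circ> x \<in> ?H.
        card {y \<in> ?X. relabel (young_snd k n (inv' x \<circ> g \<circ> x)) y = y}) = card ?Z * card ?H" .
  \<comment> \<open>Allows the factor \<open>card ?H\<close> to cancel against the denominator in
    Frobenius' formula.\<close>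
  moreover have "card ?H \<noteq> 0"
    using finH id_in_young_subgroup by (auto simp: card_eq_0_iff)
  ultimately show ?thesis
    by (simp add: induction_product_eq_sum[OF assms(2)] orbit_character_eq_card_fixed[OF assms(2)]
        flip: of_nat_sum)
qed

section \<open>Counting components\<close>

lemma connectivity_add_isolated_roots:
  assumes "labeled_rooted_forest n \<sigma>"
  shows "connectivity (add_isolated_roots n k \<sigma>) = connectivity \<sigma> \<union> Id_on {n+1..n+k}"
proof -
  let ?R = "{(x, y). {x, y} \<in> edges \<sigma>}"
  have V: "verts \<sigma> = {1..n}" and E: "\<And>e. e \<in> edges \<sigma> \<Longrightarrow> e \<subseteq> {1..n}"
    using assms by (auto simp: labeled_rooted_forest_def)
  \<comment> \<open>The closure is reflexive on all naturals, hence the first alternative; a path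
    with at least one edge stays in \<open>{1..n}\<close>. So a new vertex reaches only
    itself.\<close>
  have reach: "u = v \<or> u \<in> {1..n} \<and> v \<in> {1..n}" if "(u, v) \<in> ?R\<^sup>*" for u v
    using that by (induction rule: rtrancl_induct) (auto dest: E)
  show ?thesis
    by (auto simp: connectivity_def add_isolated_roots_def V dest: reach)
qed

text \<open>Old classes are unchanged and stay inside \<open>{1..n}\<close>, while each new vertex
  contributes a singleton class outside it.\<close>

lemma card_components_add_isolated_roots:
  assumes "labeled_rooted_forest n \<sigma>"
  shows "card (components (add_isolated_roots n k \<sigma>)) = card (components \<sigma>) + k"
proof -
  have V: "verts \<sigma> = {1..n}"
    using assms by (auto simp: labeled_rooted_forest_def)
  have conn: "connectivity \<sigma> \<subseteq> {1..n} \<times> {1..n}"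
    by (auto simp: connectivity_def V)
  have old: "connectivity (add_isolated_roots n k \<sigma>) `` {v} = connectivity \<sigma> `` {v}"
    if "v \<in> {1..n}" for v
    using that by (auto simp: connectivity_add_isolated_roots[OF assms])
  have new: "connectivity (add_isolated_roots n k \<sigma>) `` {v} = {v}" if "v \<in> {n+1..n+k}" for v
    using that conn by (auto simp: connectivity_add_isolated_roots[OF assms])
  have comp: "components \<tau> = (\<lambda>v. connectivity \<tau> `` {v}) ` verts \<tau>" for \<tau>
    by (auto simp: components_def quotient_def)
  have V': "verts (add_isolated_roots n k \<sigma>) = {1..n} \<union> {n+1..n+k}"
    by (simp add: add_isolated_roots_def V)
  have "components (add_isolated_roots n k \<sigma>) = components \<sigma> \<union> (\<lambda>v. {v}) ` {n+1..n+k}"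
    unfolding comp V V' image_Un
    by (intro arg_cong2[where f = "(\<union>)"] image_cong refl old new)
  moreover have "components \<sigma> \<inter> (\<lambda>v. {v}) ` {n+1..n+k} = {}"
    using conn by (auto simp: comp V)
  moreover have "finite (components \<sigma>)" by (simp add: comp V)
  moreover have "card ((\<lambda>v. {v}) ` {n+1..n+k}) = k" by (simp add: card_image)
  ultimately show ?thesis by (simp add: card_Un_disjoint)
qed

theorem theorem5p7:
  fixes n m k :: nat and \<sigma> :: rforest
  assumes "labeled_rooted_forest n \<sigma>"
    and "card (components \<sigma>) = m"
    and "\<not> (\<exists>v. isolated_root \<sigma> v)"
  shows "card (components (add_isolated_roots n k \<sigma>)) = m + k \<and>
    (\<forall>g \<in> carrier (sym_group (n + k)).
       orbit_character (n + k) (add_isolated_roots n k \<sigma>) g =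
       induction_product k n (one_part_character k) (orbit_character n \<sigma>) g)"
proof -
  have "isolated_free n \<sigma>"
    using assms(1,3) by (auto simp: labeled_rooted_forest_def isolated_free_def)
  then show ?thesis
    using card_components_add_isolated_roots[OF assms(1)] orbit_character_add_isolated_roots
    by (simp add: assms(2) sym_group_carrier add.commute[of n k])
qed

end
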